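(* Consider the error inhibiting method (IE-EIS-3) for $u_t=F(u)$ with time step $\Delta t$, which advances the pair $(u^{n-\frac13},u^{n})$ to $(u^{n+\frac23},u^{n+1})$ by $$u^{n+\frac23}=\tfrac{14}{5}u^{n-\frac13}-\tfrac95u^{n}+\tfrac95\Delta tF(u^{n-\frac13})-\tfrac65\Delta tF(u^{n})+\Delta tF(u^{n+\frac23}),$$ $$u^{n+1}=\tfrac{14}{5}u^{n-\frac13}-\tfrac95u^{n}+\tfrac95\Delta tF(u^{n-\frac13})-\tfrac{47}{60}\Delta tF(u^{n})-\tfrac1{12}\Delta tF(u^{n+\frac23})+\Delta tF(u^{n+1}).$$ The numerical solution produced by this method is third order accurate, and the method is A-stable.
   Context: Here $u^{n+\frac23}$ and $u^{n+1}$ approximate the exact solution at times $t_n+\frac23\Delta t$ and $t_n+\Delta t$, where $t_n=t_0+n\Delta t$. Third order accurate refers to the global error: for smooth, globally Lipschitz $F:\mathbb R^m\to\mathbb R^m$, a smooth exact solution $u$ on a fixed time interval, and starting values $u^{-\frac13},u^{0}$ with errors $O(\Delta t^3)$, the errors $u^{n}-u(t_n)$ are $O(\Delta t^{3})$ uniformly over all $t_n$ in the interval as $\Delta t\to0$. Applied to the scalar linear equation $u_t=\lambda u$ with $z=\lambda\Delta t\in\mathbb C$, the method reads $(u^{n+\frac23},u^{n+1})^T=M(z)(u^{n-\frac13},u^{n})^T$ for a $2\times2$ matrix $M(z)$. The method is A-stable if for every $z$ with $\operatorname{Re}z\le0$ all eigenvalues of $M(z)$ have modulus at most one and each eigenvalue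 of modulus one has algebraic multiplicity one. *)

theory Defs
  imports
    "HOL-Analysis.Analysis"
    "HOL-Library.Landau_Symbols"
    "Jordan_Normal_Form.Char_Poly"
begin

text \<open>
  Smoothness is meant for sets \<open>S\<close> on which Frechet derivatives are unique
  (here: the whole space and nondegenerate compact intervals). In finite dimension, continuity
  of all directional derivatives is the same as continuity of the Frechet derivative.
\<close>

primrec Ck_on :: "nat \<Rightarrow> 'a::euclidean_space set \<Rightarrow> ('a \<Rightarrow> 'b::euclidean_space) \<Rightarrow> bool" where
  "Ck_on 0 S f \<longleftrightarrow> continuous_on S f"
| "Ck_on (Suc k) S f \<longleftrightarrow>
     (\<exists>f'. (\<forall>x\<in>S. (f has_derivative f' x) (at x within S)) \<and> (\<forall>v. Ck_on k S (\<lambda>x. f' x v)))"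

definition smooth_on :: "'a::euclidean_space set \<Rightarrow> ('a \<Rightarrow> 'b::euclidean_space) \<Rightarrow> bool" where
  "smooth_on S f \<longleftrightarrow> (\<forall>k. Ck_on k S f)"

text \<open>
  A method for \<open>u' = F u\<close> that advances pairs is a relation \<open>\<Phi> F h w w'\<close>, where \<open>h\<close> is the
  time step. The old pair \<open>w\<close> approximates the solution at times \<open>t - h/3\<close> and \<open>t\<close>, the new
  pair \<open>w'\<close> at times \<open>t + 2/3 * h\<close> and \<open>t + h\<close>. It is a relation because the method is implicit.
\<close>

type_synonym 'a pair_method = "('a \<Rightarrow> 'a) \<Rightarrow> real \<Rightarrow> 'a \<times> 'a \<Rightarrow> 'a \<times> 'a \<Rightarrow> bool"

definition IE_EIS_3 :: "'a::real_vector pair_method" where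
  "IE_EIS_3 F h w w' \<longleftrightarrow>
    (case (w, w') of ((p, q), (p', q')) \<Rightarrow>
       p' = (14/5) *\<^sub>R p - (9/5) *\<^sub>R q + (9/5 * h) *\<^sub>R F p - (6/5 * h) *\<^sub>R F q + h *\<^sub>R F p' \<and>
       q' = (14/5) *\<^sub>R p - (9/5) *\<^sub>R q + (9/5 * h) *\<^sub>R F p - (47/60 * h) *\<^sub>R F q
              - (1/12 * h) *\<^sub>R F p' + h *\<^sub>R F q')"

definition numerical_solution ::
  "'a pair_method \<Rightarrow> ('a \<Rightarrow> 'a) \<Rightarrow> real \<Rightarrow> 'a \<times> 'a \<Rightarrow> (nat \<Rightarrow> 'a \<times> 'a) \<Rightarrow> bool" where
  "numerical_solution \<Phi> F h w0 w \<longleftrightarrow> w 0 = w0 \<and> (\<forall>n. \<Phi> F h (w n) (w (Suc n)))"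

text \<open>
  The exact solution lives on \<open>{a..T}\<close> with \<open>a < t0\<close>, so that \<open>u (t0 - h/3)\<close>, against
  which the first starting value is measured, makes sense for all small \<open>h\<close>. The starting values
  \<open>p0 h\<close>, \<open>q0 h\<close> may depend on the step \<open>h\<close>. Since the method is implicit, we also require that
  it determines the numerical solution uniquely for all small \<open>h\<close>.
\<close>

definition third_order_accurate :: "(real ^ 'm) pair_method \<Rightarrow> bool" where
  "third_order_accurate \<Phi> \<longleftrightarrow>
    (\<forall>(F :: real ^ 'm \<Rightarrow> real ^ 'm) (u :: real \<Rightarrow> real ^ 'm) a t0 T p0 q0.
       smooth_on UNIV F \<longrightarrow> (\<exists>L. L-lipschitz_on UNIV F) \<longrightarrow>
       a < t0 \<longrightarrow> t0 < T \<longrightarrow> smooth_on {a..T} u \<longrightarrow>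
       (\<forall>t\<in>{a..T}. (u has_vector_derivative F (u t)) (at t within {a..T})) \<longrightarrow>
       (\<lambda>h. norm (p0 h - u (t0 - h/3))) \<in> O[at_right 0](\<lambda>h. h ^ 3) \<longrightarrow>
       (\<lambda>h. norm (q0 h - u t0)) \<in> O[at_right 0](\<lambda>h. h ^ 3) \<longrightarrow>
       (\<exists>C. \<forall>\<^sub>F h in at_right 0.
          (\<exists>!w. numerical_solution \<Phi> F h (p0 h, q0 h) w) \<and>
          (\<forall>w. numerical_solution \<Phi> F h (p0 h, q0 h) w \<longrightarrow>
             (\<forall>n. t0 + real n * h \<le> T \<longrightarrow>
                norm (snd (w n) - u (t0 + real n * h)) \<le> C * h ^ 3))))"

definition is_amplification_matrix :: "complex pair_method \<Rightarrow> (complex \<Rightarrow> complex mat) \<Rightarrow> bool" where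
  "is_amplification_matrix \<Phi> M \<longleftrightarrow>
    (\<forall>z. Re z \<le> 0 \<longrightarrow> M z \<in> carrier_mat 2 2) \<and>
    (\<forall>lam h p q p' q'. h > 0 \<longrightarrow> Re (lam * of_real h) \<le> 0 \<longrightarrow>
       (\<Phi> (\<lambda>x. lam * x) h (p, q) (p', q') \<longleftrightarrow>
        vec_of_list [p', q'] = M (lam * of_real h) *\<^sub>v vec_of_list [p, q]))"

definition A_stable :: "complex pair_method \<Rightarrow> bool" where
  "A_stable \<Phi> \<longleftrightarrow>
    (\<exists>M. is_amplification_matrix \<Phi> M \<and>
      (\<forall>z. Re z \<le> 0 \<longrightarrow>
        (\<forall>\<mu>. eigenvalue (M z) \<mu> \<longrightarrow>
           norm \<mu> \<le> 1 \<and> (norm \<mu> = 1 \<longrightarrow> order \<mu> (char_poly (M z)) = 1))))"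

end

theory Submission
  imports Defs
begin

text \<open>
  \<^emph>\<open>Accuracy.\<close> The local defects of the two equations are only of order \<open>h\<^sup>3\<close>, which by the usual
  argument gives global order two. But at \<open>h = 0\<close> the method maps a pair of errors \<open>(e\<^sub>1, e\<^sub>2)\<close> to the
  pair with both components \<open>14/5 * e\<^sub>1 - 9/5 * e\<^sub>2\<close>, and the leading terms of the defects lie in the
  kernel of this map (\<open>defect_bounds\<close>). So the part of the error that is transported receives
  disturbances of order \<open>h\<^sup>4\<close> per step; the other part receives disturbances of order \<open>h\<^sup>3\<close>, but
  feeds back only with a factor \<open>h\<close> (\<open>error_step\<close>). A discrete Gronwall inequality for a weighted sum
  of the two parts gives order three (\<open>error_inhibiting_Gronwall\<close>). The implicit equations are
  uniquely solvable for small \<open>h\<close> by the Banach fixed point theorem.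

  \<^emph>\<open>A-stability.\<close> The amplification matrix has trace \<open>B / A\<close> and determinant \<open>C / A\<close> for quadratic
  polynomials \<open>A\<close>, \<open>B\<close>, \<open>C\<close> in \<open>z\<close> (\<open>char_poly_amplification\<close>). By the Schur-Cohn criterion
  (\<open>quadratic_root_condition\<close>) the eigenvalue condition follows from two inequalities between \<open>A\<close>,
  \<open>B\<close> and \<open>C\<close>, which hold in the whole left half plane because they reduce to real polynomials with
  nonnegative coefficients (\<open>left_half_plane_inequalities\<close>).
\<close>

section \<open>Solvability of the implicit steps\<close>

lemma implicit_equation_unique:
  fixes F :: "'a :: euclidean_space \<Rightarrow> 'a"
  assumes L: "L-lipschitz_on UNIV F" and h: "0 \<le> h" "h * L < 1"
  shows "\<exists>!x. x = c + h *\<^sub>R F x"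
proof -
  have "\<exists>!x. c + h *\<^sub>R F x = x"
  proof (rule banach_fix_type[of "h * L"])
    show "0 \<le> h * L" using h lipschitz_on_nonneg[OF L] by simp
    show "\<forall>x y. dist (c + h *\<^sub>R F x) (c + h *\<^sub>R F y) \<le> h * L * dist x y"
    proof (intro allI)
      fix x y
      have "dist (c + h *\<^sub>R F x) (c + h *\<^sub>R F y) = h * dist (F x) (F y)"
        using h by (simp add: dist_norm flip: scaleR_diff_right)
      also have "\<dots> \<le> h * (L * dist x y)"
        using h lipschitz_onD[OF L, of x y] by (intro mult_left_mono) auto
      finally show "dist (c + h *\<^sub>R F x) (c + h *\<^sub>R F y) \<le> h * L * dist x y"
        by simp
    qed
  qed (use h in simp)
  then show ?thesis by metis
qed

text \<open>
  The stages decouple: the first equation involves only \<open>p'\<close>, and once \<open>p'\<close> is known the second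
  involves only \<open>q'\<close>.
\<close>

lemma IE_EIS_3_step_unique:
  fixes F :: "'a :: euclidean_space \<Rightarrow> 'a"
  assumes "L-lipschitz_on UNIV F" "0 \<le> h" "h * L < 1"
  shows "\<exists>!w'. IE_EIS_3 F h w w'"
proof -
  obtain p q where w: "w = (p, q)" by (cases w)
  note unique = implicit_equation_unique[OF assms]
  obtain p' where p': "p' = (14/5) *\<^sub>R p - (9/5) *\<^sub>R q + (9/5 * h) *\<^sub>R F p - (6/5 * h) *\<^sub>R F q + h *\<^sub>R F p'"
    using unique by meson
  obtain q' where q': "q' = (14/5) *\<^sub>R p - (9/5) *\<^sub>R q + (9/5 * h) *\<^sub>R F p - (47/60 * h) *\<^sub>R F q
              - (1/12 * h) *\<^sub>R F p' + h *\<^sub>R F q'"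
    using unique by meson
  show ?thesis
  proof (rule ex1I[of _ "(p', q')"])
    show "IE_EIS_3 F h w (p', q')"
      unfolding IE_EIS_3_def w prod.case using p' q' by blast
    show "v = (p', q')" if "IE_EIS_3 F h w v" for v
    proof (cases v)
      case (Pair p2 q2)
      have "p2 = p'"
        using that p' unique unfolding IE_EIS_3_def w Pair prod.case by blast
      moreover have "q2 = q'"
        using that q' unique unfolding IE_EIS_3_def w Pair prod.case \<open>p2 = p'\<close> by blast
      ultimately show ?thesis using Pair by simp
    qed
  qed
qed

lemma numerical_solution_unique:
  assumes "\<And>w. \<exists>!w'. \<Phi> F h w w'"
  shows "\<exists>!w. numerical_solution \<Phi> F h w0 w"
proof -
  obtain g where g: "\<And>w w'. \<Phi> F h w w' \<longleftrightarrow> w' = g w"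
    using assms by metis
  show ?thesis
  proof (rule ex1I[of _ "\<lambda>n. (g ^^ n) w0"])
    show "numerical_solution \<Phi> F h w0 (\<lambda>n. (g ^^ n) w0)"
      by (simp add: numerical_solution_def g)
    show "w = (\<lambda>n. (g ^^ n) w0)" if "numerical_solution \<Phi> F h w0 w" for w
    proof
      show "w n = (g ^^ n) w0" for n
        using that by (induction n) (auto simp: numerical_solution_def g)
    qed
  qed
qed

section \<open>Taylor expansion and local defects\<close>

text \<open>
  The Frechet derivative of a curve is determined by its value at \<open>1\<close>, which is the vector derivative.
  The whole chain has to be chosen at once because \<open>Ck_on\<close> asserts each derivative by a separate
  existential.
\<close>

lemma Ck_on_interval_derivatives:
  fixes u :: "real \<Rightarrow> 'a :: euclidean_space"
  assumes "Ck_on n S u"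
  shows "\<exists>d. d 0 = u \<and> (\<forall>k<n. \<forall>t\<in>S. (d k has_vector_derivative d (Suc k) t) (at t within S))
    \<and> (\<forall>k\<le>n. continuous_on S (d k))"
  using assms
proof (induction n arbitrary: u)
  case 0
  then show ?case by (intro exI[of _ "\<lambda>_. u"]) simp
next
  case (Suc n)
  then obtain f' where f': "\<And>t. t \<in> S \<Longrightarrow> (u has_derivative f' t) (at t within S)"
    and ck: "Ck_on n S (\<lambda>t. f' t 1)"
    unfolding Ck_on.simps by blast
  obtain e where e: "e 0 = (\<lambda>t. f' t 1)"
    "\<forall>k<n. \<forall>t\<in>S. (e k has_vector_derivative e (Suc k) t) (at t within S)"
    "\<forall>k\<le>n. continuous_on S (e k)"
    using Suc.IH[OF ck] by blast
  have u: "(u has_vector_derivative f' t 1) (at t within S)" if "t \<in> S" for t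
  proof -
    have eq: "(\<lambda>x. x *\<^sub>R f' t 1) = f' t"
    proof
      show "x *\<^sub>R f' t 1 = f' t x" for x
        using linear_scale[OF has_derivative_linear[OF f'[OF that]], of x 1] by simp
    qed
    show ?thesis
      unfolding has_vector_derivative_def eq by (rule f'[OF that])
  qed
  have "continuous_on S u"
    using u by (meson continuous_on_vector_derivative)
  then show ?case
    using e u
    by (intro exI[of _ "\<lambda>k. case k of 0 \<Rightarrow> u | Suc j \<Rightarrow> e j"])
       (auto split: nat.split)
qed

text \<open>
  Pairing with a fixed vector reduces the claim to scalar functions; the vector to pair with is the
  remainder itself.
\<close>

lemma vector_Taylor:
  fixes d :: "nat \<Rightarrow> real \<Rightarrow> 'a :: euclidean_space"
  assumes S: "convex S"
    and d: "\<And>i x. x \<in> S \<Longrightarrow> i \<le> n \<Longrightarrow> (d i has_vector_derivative d (Suc i) x) (at x within S)"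
    and B: "\<And>x. x \<in> S \<Longrightarrow> norm (d (Suc n) x) \<le> B"
    and S: "t \<in> S" "t + s \<in> S"
  shows "norm (d 0 (t + s) - (\<Sum>i\<le>n. (s ^ i / fact i) *\<^sub>R d i t)) \<le> B * \<bar>s\<bar> ^ Suc n"
proof -
  define R where "R = d 0 (t + s) - (\<Sum>i\<le>n. (s ^ i / fact i) *\<^sub>R d i t)"
  have B0: "0 \<le> B" using B[OF S(1)] norm_ge_zero[of "d (Suc n) t"] by linarith
  have "norm (inner (d 0 (t + s)) R - (\<Sum>i\<le>n. inner (d i t) R * ((t + s) - t) ^ i / fact i))
      \<le> (B * norm R) * norm ((t + s) - t) ^ Suc n / fact n"
  proof (rule field_Taylor[where S = S and f = "\<lambda>i x. inner (d i x) R"])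
    show "((\<lambda>x. inner (d i x) R) has_field_derivative inner (d (Suc i) x) R) (at x within S)"
      if "x \<in> S" "i \<le> n" for i x
      using bounded_linear.has_vector_derivative[OF bounded_linear_inner_left d[OF that], of R]
      by (simp add: has_real_derivative_iff_has_vector_derivative)
    show "norm (inner (d (Suc n) x) R) \<le> B * norm R" if "x \<in> S" for x
      using Cauchy_Schwarz_ineq2[of "d (Suc n) x" R] mult_right_mono[OF B[OF that] norm_ge_zero[of R]]
      by simp
  qed (use assms in auto)
  moreover have "inner (d 0 (t + s)) R - (\<Sum>i\<le>n. inner (d i t) R * ((t + s) - t) ^ i / fact i) = inner R R"
    by (subst (3) R_def) (simp add: inner_diff_left inner_sum_left mult.commute)
  ultimately have "norm R * norm R \<le> (B * norm R) * \<bar>s\<bar> ^ Suc n / fact n"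
    by (simp add: dot_square_norm power2_eq_square)
  also have "\<dots> \<le> (B * norm R) * \<bar>s\<bar> ^ Suc n / 1"
    using B0 by (intro divide_left_mono) (auto simp: fact_ge_1)
  finally have "norm R * norm R \<le> norm R * (B * \<bar>s\<bar> ^ Suc n)"
    by (simp add: algebra_simps)
  then have "norm R \<le> B * \<bar>s\<bar> ^ Suc n"
    using B0 by (cases "R = 0") auto
  then show ?thesis unfolding R_def .
qed

lemma norm_diff_mono:
  fixes a b :: "'a :: real_normed_vector"
  shows "norm a \<le> r \<Longrightarrow> norm b \<le> s \<Longrightarrow> norm (a - b) \<le> r + s"
  using norm_triangle_ineq4[of a b] by linarith

lemma norm_scaleR_mono:
  fixes a :: "'a :: real_normed_vector"
  shows "norm a \<le> r \<Longrightarrow> norm (c *\<^sub>R a) \<le> \<bar>c\<bar> * r"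
  by (simp add: mult_left_mono)

text \<open>
  The residual left when an exact curve is put into the first equation of the method, with \<open>d 0\<close> the
  curve and \<open>d 1\<close> its derivative, which replaces \<open>F\<close> along the solution.
\<close>

definition defect1 :: "(nat \<Rightarrow> real \<Rightarrow> 'a :: real_vector) \<Rightarrow> real \<Rightarrow> real \<Rightarrow> 'a" where
  "defect1 d h t = d 0 (t + 2/3 * h) - ((14/5) *\<^sub>R d 0 (t - h/3) - (9/5) *\<^sub>R d 0 t
     + (9/5 * h) *\<^sub>R d 1 (t - h/3) - (6/5 * h) *\<^sub>R d 1 t + h *\<^sub>R d 1 (t + 2/3 * h))"

definition defect2 :: "(nat \<Rightarrow> real \<Rightarrow> 'a :: real_vector) \<Rightarrow> real \<Rightarrow> real \<Rightarrow> 'a" where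
  "defect2 d h t = d 0 (t + h) - ((14/5) *\<^sub>R d 0 (t - h/3) - (9/5) *\<^sub>R d 0 t
     + (9/5 * h) *\<^sub>R d 1 (t - h/3) - (47/60 * h) *\<^sub>R d 1 t - (1/12 * h) *\<^sub>R d 1 (t + 2/3 * h)
     + h *\<^sub>R d 1 (t + h))"

text \<open>
  The Taylor expansions of both defects start at \<open>h\<^sup>3\<close>, with coefficients \<open>-23/90\<close> and \<open>-161/405\<close> of
  the third derivative, so that their size alone only yields second order. But
  \<open>14/5 * 23/90 = 9/5 * 161/405\<close>, so the leading terms cancel in the one combination of the
  components that the method carries over to the next step. This is the error inhibiting property.
\<close>

lemma defect_bounds:
  fixes d :: "nat \<Rightarrow> real \<Rightarrow> 'a :: euclidean_space"
  assumes d: "\<And>k x. k < 4 \<Longrightarrow> x \<in> {a..T} \<Longrightarrow>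
      (d k has_vector_derivative d (Suc k) x) (at x within {a..T})"
    and B3: "\<And>x. x \<in> {a..T} \<Longrightarrow> norm (d 3 x) \<le> B"
    and B4: "\<And>x. x \<in> {a..T} \<Longrightarrow> norm (d 4 x) \<le> B"
    and h: "0 < h" "h \<le> 1" and t: "a \<le> t - h/3" "t + h \<le> T"
  shows "norm (defect1 d h t) \<le> 8 * B * h ^ 3"
    and "norm (defect2 d h t) \<le> 8 * B * h ^ 3"
    and "norm ((14/5) *\<^sub>R defect1 d h t - (9/5) *\<^sub>R defect2 d h t) \<le> 33 * B * h ^ 4"
proof -
  define r0 where "r0 s = d 0 (t + s) - (d 0 t + s *\<^sub>R d 1 t + (s^2/2) *\<^sub>R d 2 t + (s^3/6) *\<^sub>R d 3 t)" for s
  define r1 where "r1 s = d 1 (t + s) - (d 1 t + s *\<^sub>R d 2 t + (s^2/2) *\<^sub>R d 3 t)" for s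
  have tin: "t \<in> {a..T}" using h t by auto
  have B0: "0 \<le> B" using B3[OF tin] norm_ge_zero[of "d 3 t"] by linarith
  have R0: "norm (r0 s) \<le> B * h ^ 4" if "t + s \<in> {a..T}" "\<bar>s\<bar> \<le> h" for s
  proof -
    have "norm (d 0 (t + s) - (\<Sum>i\<le>3. (s ^ i / fact i) *\<^sub>R d i t)) \<le> B * \<bar>s\<bar> ^ Suc 3"
      by (rule vector_Taylor[where S = "{a..T}"]) (use d B4 tin that in auto)
    also have "\<dots> \<le> B * h ^ 4"
      using power_mono[OF that(2), of 4] B0 by (simp add: mult_left_mono)
    finally show ?thesis
      by (simp add: r0_def eval_nat_numeral)
  qed
  have R1: "norm (h *\<^sub>R r1 s) \<le> B * h ^ 4" if "t + s \<in> {a..T}" "\<bar>s\<bar> \<le> h" for s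
  proof -
    have "norm (d (Suc 0) (t + s) - (\<Sum>i\<le>2. (s ^ i / fact i) *\<^sub>R d (Suc i) t)) \<le> B * \<bar>s\<bar> ^ Suc 2"
      by (rule vector_Taylor[where S = "{a..T}" and d = "\<lambda>i. d (Suc i)"]) (use d B4 tin that in auto)
    also have "\<dots> \<le> B * h ^ 3"
      using power_mono[OF that(2), of 3] B0 by (simp add: mult_left_mono)
    finally have "norm (r1 s) \<le> B * h ^ 3"
      by (simp add: r1_def eval_nat_numeral)
    then have "h * norm (r1 s) \<le> h * (B * h ^ 3)"
      using h by (intro mult_left_mono) auto
    then show ?thesis using h by (simp add: eval_nat_numeral algebra_simps)
  qed
  have d0: "d 0 (t + s) = r0 s + (d 0 t + s *\<^sub>R d 1 t + (s^2/2) *\<^sub>R d 2 t + (s^3/6) *\<^sub>R d 3 t)" for s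
    by (simp add: r0_def)
  have d1: "d 1 (t + s) = r1 s + (d 1 t + s *\<^sub>R d 2 t + (s^2/2) *\<^sub>R d 3 t)" for s
    by (simp add: r1_def)
  have m: "t - h/3 = t + (- h/3)" by simp
  define E1 where "E1 = r0 (2/3 * h) - (14/5) *\<^sub>R r0 (- h/3) - (9/5) *\<^sub>R (h *\<^sub>R r1 (- h/3)) - h *\<^sub>R r1 (2/3 * h)"
  define E2 where "E2 = r0 h - (14/5) *\<^sub>R r0 (- h/3) - (9/5) *\<^sub>R (h *\<^sub>R r1 (- h/3))
    - (- 1/12) *\<^sub>R (h *\<^sub>R r1 (2/3 * h)) - h *\<^sub>R r1 h"
  have D1: "defect1 d h t = E1 - (23/90 * h^3) *\<^sub>R d 3 t"
    unfolding defect1_def m d0 d1 E1_def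
    by (rule euclidean_eqI) (simp add: inner_simps, simp add: eval_nat_numeral field_simps)
  have D2: "defect2 d h t = E2 - (161/405 * h^3) *\<^sub>R d 3 t"
    unfolding defect2_def m d0 d1 E2_def
    by (rule euclidean_eqI) (simp add: inner_simps, simp add: eval_nat_numeral field_simps)
  have s: "t + - h/3 \<in> {a..T}" "t + 2/3 * h \<in> {a..T}" "t + h \<in> {a..T}"
    "\<bar>- h/3\<bar> \<le> h" "\<bar>2/3 * h\<bar> \<le> h" "\<bar>h\<bar> \<le> h"
    using h t by auto
  have "norm E1 \<le> B * h^4 + \<bar>14/5\<bar> * (B * h^4) + \<bar>9/5\<bar> * (B * h^4) + B * h^4"
    unfolding E1_def by (intro norm_diff_mono norm_scaleR_mono[of _ "B * h^4"] R0 R1 s)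
  moreover have Bh4: "0 \<le> B * h^4" using B0 h by simp
  ultimately have E1: "norm E1 \<le> 7 * (B * h^4)"
    by simp
  have "norm E2 \<le> B * h^4 + \<bar>14/5\<bar> * (B * h^4) + \<bar>9/5\<bar> * (B * h^4) + \<bar>- 1/12\<bar> * (B * h^4) + B * h^4"
    unfolding E2_def by (intro norm_diff_mono norm_scaleR_mono[of _ "B * h^4"] R0 R1 s)
  then have E2: "norm E2 \<le> 7 * (B * h^4)"
    using Bh4 by simp
  have h34: "B * h^4 \<le> B * h^3"
    using B0 h by (intro mult_left_mono power_decreasing) auto
  have Bh3: "0 \<le> B * h^3" using B0 h by simp
  have T: "norm ((c * h^3) *\<^sub>R d 3 t) \<le> c * (B * h^3)" if "0 \<le> c" for c
    using norm_scaleR_mono[OF B3[OF tin], of "c * h^3"] h that by (simp add: abs_mult algebra_simps)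
  show "norm (defect1 d h t) \<le> 8 * B * h ^ 3"
    using norm_diff_mono[OF E1 T[of "23/90"]] h34 Bh3 unfolding D1 by simp
  show "norm (defect2 d h t) \<le> 8 * B * h ^ 3"
    using norm_diff_mono[OF E2 T[of "161/405"]] h34 Bh3 unfolding D2 by simp
  have "(14/5) *\<^sub>R defect1 d h t - (9/5) *\<^sub>R defect2 d h t = (14/5) *\<^sub>R E1 - (9/5) *\<^sub>R E2"
    unfolding D1 D2 by (rule euclidean_eqI) (simp add: inner_simps algebra_simps)
  then show "norm ((14/5) *\<^sub>R defect1 d h t - (9/5) *\<^sub>R defect2 d h t) \<le> 33 * B * h ^ 4"
    using norm_diff_mono[OF norm_scaleR_mono[OF E1, of "14/5"] norm_scaleR_mono[OF E2, of "9/5"]]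
      Bh4 by simp
qed

section \<open>Propagation of the error\<close>

text \<open>
  For \<open>h = 0\<close> both components of the new error equal the combination \<open>14/5 * e\<^sub>1 - 9/5 * e\<^sub>2\<close> of the old
  ones, and since \<open>14/5 - 9/5 = 1\<close> this combination is itself preserved. Therefore its norm \<open>s\<close> is
  estimated separately from the full error \<open>m\<close>: the defects enter \<open>s\<close> only through their combination,
  and only \<open>s\<close> is passed on without a factor \<open>h\<close>.
\<close>

lemma error_step:
  fixes F :: "'a :: euclidean_space \<Rightarrow> 'a"
  assumes L: "L-lipschitz_on UNIV F" and h: "0 \<le> h"
    and step: "IE_EIS_3 F h (p, q) (p', q')"
    and exact: "P' - ((14/5) *\<^sub>R P - (9/5) *\<^sub>R Q + (9/5 * h) *\<^sub>R F P - (6/5 * h) *\<^sub>R F Q + h *\<^sub>R F P') = D1"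
      "Q' - ((14/5) *\<^sub>R P - (9/5) *\<^sub>R Q + (9/5 * h) *\<^sub>R F P - (47/60 * h) *\<^sub>R F Q
              - (1/12 * h) *\<^sub>R F P' + h *\<^sub>R F Q') = D2"
  defines "s \<equiv> norm ((14/5) *\<^sub>R (p - P) - (9/5) *\<^sub>R (q - Q))" and "m \<equiv> norm (p - P) + norm (q - Q)"
    and "s' \<equiv> norm ((14/5) *\<^sub>R (p' - P') - (9/5) *\<^sub>R (q' - Q'))" and "m' \<equiv> norm (p' - P') + norm (q' - Q')"
  shows "m' \<le> 2 * s + h * (10 * L) * (m + m') + norm D1 + norm D2"
    and "s' \<le> s + h * (10 * L) * (m + m') + norm ((14/5) *\<^sub>R D1 - (9/5) *\<^sub>R D2)"
proof -
  define S where "S = (14/5) *\<^sub>R (p - P) - (9/5) *\<^sub>R (q - Q)"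
  define G1 where "G1 = (9/5) *\<^sub>R (F p - F P) - (6/5) *\<^sub>R (F q - F Q) + (F p' - F P')"
  define G2 where "G2 = (9/5) *\<^sub>R (F p - F P) - (47/60) *\<^sub>R (F q - F Q) - (1/12) *\<^sub>R (F p' - F P') + (F q' - F Q')"
  have p': "p' = (14/5) *\<^sub>R p - (9/5) *\<^sub>R q + (9/5 * h) *\<^sub>R F p - (6/5 * h) *\<^sub>R F q + h *\<^sub>R F p'"
    and q': "q' = (14/5) *\<^sub>R p - (9/5) *\<^sub>R q + (9/5 * h) *\<^sub>R F p - (47/60 * h) *\<^sub>R F q
              - (1/12 * h) *\<^sub>R F p' + h *\<^sub>R F q'"
    using step unfolding IE_EIS_3_def prod.case by blast+
  have ep: "p' - P' = S + h *\<^sub>R G1 - D1"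
    by (subst p') (simp add: S_def G1_def exact(1)[symmetric] algebra_simps)
  have eq: "q' - Q' = S + h *\<^sub>R G2 - D2"
    by (subst q') (simp add: S_def G2_def exact(2)[symmetric] algebra_simps)
  have S': "(14/5) *\<^sub>R (p' - P') - (9/5) *\<^sub>R (q' - Q')
      = S + h *\<^sub>R ((14/5) *\<^sub>R G1 - (9/5) *\<^sub>R G2) - ((14/5) *\<^sub>R D1 - (9/5) *\<^sub>R D2)"
    unfolding ep eq by (rule euclidean_eqI) (simp add: inner_simps algebra_simps)
  have Lip: "norm (F x - F y) \<le> L * norm (x - y)" for x y
    using lipschitz_onD[OF L, of x y] by (simp add: dist_norm)
  have L0: "0 \<le> L" using lipschitz_on_nonneg[OF L] .
  have nn: "0 \<le> L * norm (p - P)" "0 \<le> L * norm (q - Q)" "0 \<le> L * norm (p' - P')" "0 \<le> L * norm (q' - Q')"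
    using L0 by auto
  have mm: "L * (m + m') = L * norm (p - P) + L * norm (q - Q) + L * norm (p' - P') + L * norm (q' - Q')"
    by (simp add: m_def m'_def algebra_simps)
  have "norm G1 \<le> \<bar>9/5\<bar> * (L * norm (p - P)) + \<bar>6/5\<bar> * (L * norm (q - Q)) + L * norm (p' - P')"
    unfolding G1_def by (intro norm_triangle_mono norm_diff_mono norm_scaleR_mono Lip)
  also have "\<dots> \<le> 2 * (L * (m + m'))" using nn unfolding mm by simp
  finally have G1: "norm G1 \<le> 2 * (L * (m + m'))" .
  have "norm G2 \<le> \<bar>9/5\<bar> * (L * norm (p - P)) + \<bar>47/60\<bar> * (L * norm (q - Q))
      + \<bar>1/12\<bar> * (L * norm (p' - P')) + L * norm (q' - Q')"
    unfolding G2_def by (intro norm_triangle_mono norm_diff_mono norm_scaleR_mono Lip)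
  also have "\<dots> \<le> 2 * (L * (m + m'))" using nn unfolding mm by simp
  finally have G2: "norm G2 \<le> 2 * (L * (m + m'))" .
  have hL: "0 \<le> h * (L * (m + m'))" using h L0 by (simp add: m_def m'_def)
  have 1: "norm (p' - P') \<le> s + \<bar>h\<bar> * (2 * (L * (m + m'))) + norm D1"
    unfolding ep s_def S_def[symmetric]
    by (intro norm_diff_mono norm_triangle_mono norm_scaleR_mono G1 order_refl)
  have 2: "norm (q' - Q') \<le> s + \<bar>h\<bar> * (2 * (L * (m + m'))) + norm D2"
    unfolding eq s_def S_def[symmetric]
    by (intro norm_diff_mono norm_triangle_mono norm_scaleR_mono G2 order_refl)
  have "m' \<le> 2 * s + 4 * (h * (L * (m + m'))) + norm D1 + norm D2"
    using 1 2 h by (simp add: m'_def algebra_simps)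
  then show "m' \<le> 2 * s + h * (10 * L) * (m + m') + norm D1 + norm D2"
    using hL by simp
  have "s' \<le> s + \<bar>h\<bar> * (\<bar>14/5\<bar> * (2 * (L * (m + m'))) + \<bar>9/5\<bar> * (2 * (L * (m + m'))))
      + norm ((14/5) *\<^sub>R D1 - (9/5) *\<^sub>R D2)"
    unfolding s'_def S' s_def S_def[symmetric]
    by (intro norm_diff_mono norm_triangle_mono norm_scaleR_mono G1 G2 order_refl)
  also have "\<dots> = s + 46/5 * (h * (L * (m + m'))) + norm ((14/5) *\<^sub>R D1 - (9/5) *\<^sub>R D2)"
    using h by simp
  finally show "s' \<le> s + h * (10 * L) * (m + m') + norm ((14/5) *\<^sub>R D1 - (9/5) *\<^sub>R D2)"
    using hL by simp
qed

text \<open>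
  A disturbance of size \<open>h\<^sup>3\<close> per step in \<open>m\<close> is harmless, since \<open>m\<close> acts on the next step only through
  the factor \<open>h * C\<close>. The quantity \<open>X = s + 2 * C * h * m\<close> accounts for this: it grows per step by a
  factor \<open>1 + 12 * C * h\<close> and an increment of order \<open>h\<^sup>4\<close>, so the discrete Gronwall argument keeps it of
  order \<open>h\<^sup>3\<close>. One further use of the recursion for \<open>m\<close> then bounds \<open>m\<close>, since \<open>m (Suc k)\<close> is at most
  \<open>4 * X k\<close> up to order \<open>h\<^sup>3\<close>; the weight of \<open>m\<close> in \<open>X\<close> alone would only give order \<open>h\<^sup>2\<close>.
\<close>

lemma error_inhibiting_Gronwall:
  fixes s m :: "nat \<Rightarrow> real"
  assumes C: "0 \<le> C" and h: "0 < h" "12 * (C * h) \<le> 1"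
    and nonneg: "\<And>k. 0 \<le> s k" "\<And>k. 0 \<le> m k"
    and m: "\<And>k. k < N \<Longrightarrow> m (Suc k) \<le> 2 * s k + h * C * (m k + m (Suc k)) + C * h ^ 3"
    and s: "\<And>k. k < N \<Longrightarrow> s (Suc k) \<le> s k + h * C * (m k + m (Suc k)) + C * h ^ 4"
    and init: "s 0 \<le> K * h ^ 3" "m 0 \<le> K * h ^ 3"
    and N: "real N * h \<le> \<tau>"
  shows "m N \<le> (K + 4 * (exp (12 * C * \<tau>) * (2 * K + \<tau> * (C * (1 + 6 * C)))) + 2 * C) * h ^ 3"
proof -
  define x where "x = C * h"
  have x: "0 \<le> x" "12 * x \<le> 1" "h * C = x"
    using C h by (simp_all add: x_def)
  define X where "X k = s k + 2 * x * m k" for k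
  have X0: "0 \<le> X k" for k using nonneg x by (simp add: X_def)
  \<comment> \<open>The implicit term is absorbed on the left because \<open>12 * x \<le> 1\<close>.\<close>
  have m': "m (Suc k) \<le> 4 * s k + 2 * x * m k + 2 * C * h^3" if "k < N" for k
  proof -
    have "12 * x * m (Suc k) \<le> 1 * m (Suc k)"
      using x nonneg by (intro mult_right_mono) auto
    moreover have "m (Suc k) \<le> 2 * s k + (x * m k + x * m (Suc k)) + C * h^3"
      using m[OF that] unfolding x(3) by (simp add: algebra_simps)
    moreover have "0 \<le> x * m k" "0 \<le> C * h^3" "0 \<le> s k"
      using nonneg x C h by auto
    ultimately show ?thesis by simp
  qed
  define b where "b = C * (1 + 6 * C) * h ^ 4"
  have b: "0 \<le> b" "b = 6 * x * (C * h^3) + C * h^4"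
    using C h by (simp_all add: b_def x_def eval_nat_numeral algebra_simps)
  have X': "X (Suc k) \<le> (1 + 12 * x) * X k + b" if "k < N" for k
  proof -
    have "X (Suc k) \<le> s k + x * m k + 3 * x * m (Suc k) + C * h^4"
      using s[OF that] unfolding x(3) by (simp add: X_def algebra_simps)
    also have "3 * x * m (Suc k) \<le> 3 * x * (4 * s k + 2 * x * m k + 2 * C * h^3)"
      using m'[OF that] x by (intro mult_left_mono) auto
    also have "\<dots> = 12 * x * s k + 6 * x * (x * m k) + 6 * x * (C * h^3)"
      by (simp add: algebra_simps)
    also have "6 * x * (x * m k) \<le> 1 * (x * m k)"
      using x nonneg by (intro mult_right_mono) auto
    finally have "X (Suc k) \<le> (1 + 12 * x) * s k + 2 * x * m k + b"
      unfolding b by (simp add: algebra_simps)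
    also have "2 * x * m k \<le> (1 + 12 * x) * (2 * x * m k)"
      using x nonneg mult_right_mono[of 1 "1 + 12 * x" "2 * x * m k"] by simp
    finally show ?thesis by (simp add: X_def algebra_simps)
  qed
  have Xpow: "X n \<le> (1 + 12 * x) ^ n * (X 0 + real n * b)" if "n \<le> N" for n
    using that
  proof (induction n)
    case (Suc n)
    have "X (Suc n) \<le> (1 + 12 * x) * X n + b" using X' Suc.prems by simp
    moreover have "(1 + 12 * x) * X n \<le> (1 + 12 * x) * ((1 + 12 * x) ^ n * (X 0 + real n * b))"
      using Suc x by (intro mult_left_mono) auto
    moreover have "b \<le> (1 + 12 * x) ^ Suc n * b"
      using b x mult_right_mono[OF one_le_power[of "1 + 12 * x" "Suc n"], of b] by simp
    ultimately show ?case by (simp add: algebra_simps)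
  qed simp
  define K1 where "K1 = exp (12 * C * \<tau>) * (2 * K + \<tau> * (C * (1 + 6 * C)))"
  have "0 \<le> K * h^3" using init(2) nonneg(2)[of 0] by linarith
  then have K: "0 \<le> K" using h by (simp add: zero_le_mult_iff)
  have "0 \<le> real N * h" using h by simp
  then have \<tau>: "0 \<le> \<tau>" using N by linarith
  have XK1: "X n \<le> K1 * h ^ 3" if n: "n \<le> N" for n
  proof -
    have nh: "real n * h \<le> \<tau>"
    proof -
      have "real n * h \<le> real N * h" using n h by (intro mult_right_mono) auto
      then show ?thesis using N by linarith
    qed
    have "2 * x * m 0 \<le> 1 * m 0"
      using x nonneg by (intro mult_right_mono) auto
    then have "X 0 \<le> 2 * K * h^3"
      using init by (simp add: X_def)
    moreover have "real n * b \<le> \<tau> * (C * (1 + 6 * C)) * h^3"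
    proof -
      have "real n * b = (real n * h) * (C * (1 + 6 * C) * h^3)"
        by (simp add: b_def eval_nat_numeral)
      also have "\<dots> \<le> \<tau> * (C * (1 + 6 * C) * h^3)"
        using nh C h by (intro mult_right_mono) auto
      finally show ?thesis by simp
    qed
    ultimately have 1: "X 0 + real n * b \<le> (2 * K + \<tau> * (C * (1 + 6 * C))) * h^3"
      by (simp add: algebra_simps)
    have "(1 + 12 * x) ^ n \<le> exp (12 * x) ^ n"
      using x by (intro power_mono exp_ge_add_one_self) auto
    also have "\<dots> = exp (12 * C * (real n * h))"
      by (simp add: x_def mult_ac flip: exp_of_nat_mult)
    also have "\<dots> \<le> exp (12 * C * \<tau>)"
      using nh C by (simp add: mult_left_mono)
    finally have 2: "(1 + 12 * x) ^ n \<le> exp (12 * C * \<tau>)" .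
    have "X n \<le> exp (12 * C * \<tau>) * ((2 * K + \<tau> * (C * (1 + 6 * C))) * h^3)"
      using X0[of 0] b by (intro order_trans[OF Xpow[OF n]] mult_mono 1 2) auto
    then show ?thesis by (simp add: K1_def mult.assoc)
  qed
  have K1: "0 \<le> K1" using K C \<tau> by (simp add: K1_def)
  have "m N \<le> (K + 4 * K1 + 2 * C) * h^3"
  proof (cases N)
    case 0
    have "0 \<le> (4 * K1 + 2 * C) * h^3" using K1 C h by simp
    then show ?thesis using init 0 by (simp add: algebra_simps)
  next
    case (Suc k)
    have "m N \<le> 4 * s k + 2 * x * m k + 2 * C * h^3" using m'[of k] Suc by simp
    also have "\<dots> \<le> 4 * X k + 2 * C * h^3"
      using x nonneg[of k] by (simp add: X_def)
    also have "\<dots> \<le> 4 * (K1 * h^3) + 2 * C * h^3" using XK1[of k] Suc by simp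
    finally show ?thesis using \<open>0 \<le> K * h^3\<close> by (simp add: algebra_simps)
  qed
  then show ?thesis unfolding K1_def .
qed

section \<open>Third order accuracy\<close>

lemma bounded_of_continuous_on_interval:
  fixes f :: "real \<Rightarrow> 'a :: real_normed_vector"
  assumes "continuous_on {a..b} f"
  shows "\<exists>B\<ge>0. \<forall>x\<in>{a..b}. norm (f x) \<le> B"
proof -
  have "bounded (f ` {a..b})"
    using assms by (intro compact_imp_bounded compact_continuous_image) auto
  then obtain B where B: "\<forall>x\<in>{a..b}. norm (f x) \<le> B"
    by (auto simp: bounded_iff)
  then show ?thesis by (intro exI[of _ "max B 0"]) auto
qed

lemma third_order_accurate_IE_EIS_3: "third_order_accurate (IE_EIS_3 :: (real ^ 'm) pair_method)"
  unfolding third_order_accurate_def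
proof (intro allI impI)
  fix F :: "real ^ 'm \<Rightarrow> real ^ 'm" and u :: "real \<Rightarrow> real ^ 'm" and a t0 T :: real and p0 q0
  assume "\<exists>L. L-lipschitz_on UNIV F" and a: "a < t0" and T: "t0 < T"
    and u: "smooth_on {a..T} u"
    and ode: "\<forall>t\<in>{a..T}. (u has_vector_derivative F (u t)) (at t within {a..T})"
    and p0: "(\<lambda>h. norm (p0 h - u (t0 - h/3))) \<in> O[at_right 0](\<lambda>h. h ^ 3)"
    and q0: "(\<lambda>h. norm (q0 h - u t0)) \<in> O[at_right 0](\<lambda>h. h ^ 3)"
  then obtain L where L: "L-lipschitz_on UNIV F" by blast
  have L0: "0 \<le> L" using lipschitz_on_nonneg[OF L] .
  have "Ck_on 4 {a..T} u" using u by (simp add: smooth_on_def)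
  then obtain d where d0: "d 0 = u"
    and d: "\<And>k t. k < 4 \<Longrightarrow> t \<in> {a..T} \<Longrightarrow> (d k has_vector_derivative d (Suc k) t) (at t within {a..T})"
    and dc: "\<And>k. k \<le> 4 \<Longrightarrow> continuous_on {a..T} (d k)"
    using Ck_on_interval_derivatives by blast
  have d1: "d 1 t = F (u t)" if "t \<in> {a..T}" for t
    using vector_derivative_unique_within_closed_interval[of a T t "d 0" "d 1 t" "F (u t)"]
      d[of 0 t] ode that a T by (simp add: d0)
  obtain B3 where B3: "0 \<le> B3" "\<And>x. x \<in> {a..T} \<Longrightarrow> norm (d 3 x) \<le> B3"
    using bounded_of_continuous_on_interval[OF dc[of 3]] by auto
  obtain B4 where B4: "0 \<le> B4" "\<And>x. x \<in> {a..T} \<Longrightarrow> norm (d 4 x) \<le> B4"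
    using bounded_of_continuous_on_interval[OF dc[of 4]] by auto
  define B where "B = max B3 B4"
  have B: "0 \<le> B" "\<And>x. x \<in> {a..T} \<Longrightarrow> norm (d 3 x) \<le> B" "\<And>x. x \<in> {a..T} \<Longrightarrow> norm (d 4 x) \<le> B"
    using B3 B4 by (force simp: B_def)+
  obtain c1 where c1: "c1 > 0" "\<forall>\<^sub>F h in at_right 0. norm (norm (p0 h - u (t0 - h/3))) \<le> c1 * norm (h ^ 3)"
    using landau_o.bigE[OF p0] by blast
  obtain c2 where c2: "c2 > 0" "\<forall>\<^sub>F h in at_right 0. norm (norm (q0 h - u t0)) \<le> c2 * norm (h ^ 3)"
    using landau_o.bigE[OF q0] by blast
  \<comment> \<open>Large enough to dominate \<open>10 * L\<close>, the sum \<open>16 * B\<close> of the two defect bounds, and \<open>33 * B\<close>.\<close>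
  define C where "C = 10 * L + 33 * B"
  define K where "K = 5 * (c1 + c2)"
  define K' where "K' = K + 4 * (exp (12 * C * (T - t0)) * (2 * K + (T - t0) * (C * (1 + 6 * C)))) + 2 * C"
  have C: "0 \<le> C" "10 * L \<le> C" "16 * B \<le> C" "33 * B \<le> C"
    using L0 B(1) by (simp_all add: C_def)
  have small: "\<forall>\<^sub>F h in at_right 0. 0 < h \<and> h < min 1 (min (1 / (12 * C + 1)) (3 * (t0 - a)))"
    unfolding eventually_at_right_field
    by (rule exI[of _ "min 1 (min (1 / (12 * C + 1)) (3 * (t0 - a)))"]) (use C a in auto)
  show "\<exists>C. \<forall>\<^sub>F h in at_right 0.
          (\<exists>!w. numerical_solution IE_EIS_3 F h (p0 h, q0 h) w) \<and>
          (\<forall>w. numerical_solution IE_EIS_3 F h (p0 h, q0 h) w \<longrightarrow>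
             (\<forall>n. t0 + real n * h \<le> T \<longrightarrow>
                norm (snd (w n) - u (t0 + real n * h)) \<le> C * h ^ 3))"
  proof (rule exI[of _ K'], use small c1(2) c2(2) in eventually_elim, intro conjI allI impI)
    fix h
    assume h': "0 < h \<and> h < min 1 (min (1 / (12 * C + 1)) (3 * (t0 - a)))"
      and p0h: "norm (norm (p0 h - u (t0 - h/3))) \<le> c1 * norm (h ^ 3)"
      and q0h: "norm (norm (q0 h - u t0)) \<le> c2 * norm (h ^ 3)"
    have h: "0 < h" "h \<le> 1" "a \<le> t0 - h/3" using h' by auto
    have "h * (12 * C + 1) < 1" using h' C by (simp add: pos_less_divide_eq)
    then have Ch: "12 * (C * h) \<le> 1" using h by (simp add: algebra_simps)
    have hL: "h * L < 1"
    proof -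
      have "10 * (h * L) \<le> C * h"
        using mult_right_mono[OF C(2), of h] h by (simp add: mult_ac)
      then show ?thesis using Ch by linarith
    qed
    show "\<exists>!w. numerical_solution IE_EIS_3 F h (p0 h, q0 h) w"
      by (intro numerical_solution_unique IE_EIS_3_step_unique[OF L _ hL]) (use h in simp)
    fix w n
    assume w: "numerical_solution IE_EIS_3 F h (p0 h, q0 h) w" and n: "t0 + real n * h \<le> T"
    define t where "t k = t0 + real k * h" for k
    define s where "s k = norm ((14/5) *\<^sub>R (fst (w k) - u (t k - h/3)) - (9/5) *\<^sub>R (snd (w k) - u (t k)))" for k
    define m where "m k = norm (fst (w k) - u (t k - h/3)) + norm (snd (w k) - u (t k))" for k
    have "m n \<le> K' * h ^ 3"
      unfolding K'_def
    proof (rule error_inhibiting_Gronwall[where s = s and m = m])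
      fix k assume k: "k < n"
      have tk: "a \<le> t k - h/3" "t k + h \<le> T"
      proof -
        have "0 \<le> real k * h" using h by simp
        then show "a \<le> t k - h/3" using h unfolding t_def by linarith
        have "real (Suc k) * h \<le> real n * h" using k h by (intro mult_right_mono) auto
        then show "t k + h \<le> T" using n by (simp add: t_def algebra_simps)
      qed
      have in_interval: "t k \<in> {a..T}" "t k - h/3 \<in> {a..T}" "t k + 2/3 * h \<in> {a..T}" "t k + h \<in> {a..T}"
        using tk h by auto
      have next_t: "t (Suc k) = t k + h" "t k + h - h/3 = t k + 2/3 * h"
        by (simp_all add: t_def algebra_simps)
      have step: "IE_EIS_3 F h (fst (w k), snd (w k)) (fst (w (Suc k)), snd (w (Suc k)))"
        using w by (simp add: numerical_solution_def)
      note defect = defect_bounds[OF d B(2,3) h(1,2) tk]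
      note err = error_step[OF L less_imp_le[OF h(1)] step,
          of "u (t k + 2/3 * h)" "u (t k - h/3)" "u (t k)" "defect1 d h (t k)" "u (t k + h)" "defect2 d h (t k)"]
      have exact: "defect1 d h (t k) = u (t k + 2/3 * h) - ((14/5) *\<^sub>R u (t k - h/3) - (9/5) *\<^sub>R u (t k)
          + (9/5 * h) *\<^sub>R F (u (t k - h/3)) - (6/5 * h) *\<^sub>R F (u (t k)) + h *\<^sub>R F (u (t k + 2/3 * h)))"
        "defect2 d h (t k) = u (t k + h) - ((14/5) *\<^sub>R u (t k - h/3) - (9/5) *\<^sub>R u (t k)
          + (9/5 * h) *\<^sub>R F (u (t k - h/3)) - (47/60 * h) *\<^sub>R F (u (t k))
          - (1/12 * h) *\<^sub>R F (u (t k + 2/3 * h)) + h *\<^sub>R F (u (t k + h)))"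
        unfolding defect1_def defect2_def d0 by (simp_all only: d1 in_interval)
      have s_m: "s (Suc k) = norm ((14/5) *\<^sub>R (fst (w (Suc k)) - u (t k + 2/3 * h))
            - (9/5) *\<^sub>R (snd (w (Suc k)) - u (t k + h)))"
        "m (Suc k) = norm (fst (w (Suc k)) - u (t k + 2/3 * h)) + norm (snd (w (Suc k)) - u (t k + h))"
        unfolding s_def m_def next_t by simp_all
      note err = err[OF exact(1)[symmetric] exact(2)[symmetric], folded s_m s_def m_def]
      have mm: "0 \<le> h * (m k + m (Suc k))"
        using h by (simp add: m_def)
      have LC: "h * (10 * L) * (m k + m (Suc k)) \<le> h * C * (m k + m (Suc k))"
        using mult_right_mono[OF C(2) mm] by (simp add: mult_ac)
      have "8 * B * h^3 + 8 * B * h^3 \<le> C * h^3"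
        using mult_right_mono[OF C(3), of "h^3"] h by (simp add: algebra_simps)
      then show "m (Suc k) \<le> 2 * s k + h * C * (m k + m (Suc k)) + C * h ^ 3"
        using err(1) defect(1,2) LC by linarith
      have "33 * B * h^4 \<le> C * h^4"
        using mult_right_mono[OF C(4), of "h^4"] h by simp
      then show "s (Suc k) \<le> s k + h * C * (m k + m (Suc k)) + C * h ^ 4"
        using err(2) defect(3) LC by linarith
    next
      have w0: "w 0 = (p0 h, q0 h)" using w by (simp add: numerical_solution_def)
      have t0: "t 0 = t0" by (simp add: t_def)
      have h3: "0 \<le> c1 * h^3" "0 \<le> c2 * h^3" using c1 c2 h by auto
      have pq: "norm (p0 h - u (t0 - h/3)) \<le> c1 * h^3" "norm (q0 h - u t0) \<le> c2 * h^3"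
        using p0h q0h h by auto
      show "m 0 \<le> K * h^3"
        using pq h3 unfolding m_def w0 t0 K_def by (simp add: algebra_simps)
      show "s 0 \<le> K * h^3"
        using norm_diff_mono[OF norm_scaleR_mono[OF pq(1), of "14/5"] norm_scaleR_mono[OF pq(2), of "9/5"]] h3
        unfolding s_def w0 t0 K_def by (simp add: algebra_simps)
    qed (use C Ch h n in \<open>auto simp: s_def m_def\<close>)
    then show "norm (snd (w n) - u (t0 + real n * h)) \<le> K' * h ^ 3"
      using norm_ge_zero[of "fst (w n) - u (t n - h/3)"] unfolding m_def t_def by linarith
  qed
qed

section \<open>Eigenvalues of the amplification matrix\<close>

lemma char_poly_2x2:
  fixes a b c d :: "'a :: field"
  shows "char_poly (mat_of_rows_list 2 [[a, b], [c, d]]) = [:a * d - b * c, - (a + d), 1:]"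
proof -
  let ?A = "mat_of_rows_list 2 [[a, b], [c, d]]"
  have A: "?A \<in> carrier_mat 2 2"
    by (auto simp: mat_of_rows_list_def)
  show ?thesis
    unfolding char_poly_def
    by (subst laplace_expansion_row[OF char_poly_matrix_closed[OF A], of 0])
      (auto simp: cofactor_def det_single mat_delete_def char_poly_matrix_def mat_of_rows_list_def
        numeral_2_eq_2 lessThan_Suc algebra_simps)
qed

text \<open>
  The left side is the Schur-Cohn expression of the monic quadratic with roots \<open>\<mu>\<close> and \<open>\<nu>\<close>, whose
  coefficients are known; the right side shows its sign once one root leaves the unit disk.
\<close>

lemma schur_cohn_identity:
  fixes \<mu> \<nu> :: complex
  shows "(1 - (cmod (\<mu> * \<nu>))\<^sup>2)\<^sup>2 - (cmod ((\<mu> + \<nu>) - \<mu> * \<nu> * cnj (\<mu> + \<nu>)))\<^sup>2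
       = (1 - (cmod \<mu>)\<^sup>2) * (1 - (cmod \<nu>)\<^sup>2) * (cmod (1 - \<mu> * cnj \<nu>))\<^sup>2"
  unfolding cmod_power2 by (simp add: power2_eq_square algebra_simps)

text \<open>
  A root outside the closed unit disk would force the other root inside, as their product \<open>D\<close> is
  small; then the Schur-Cohn expression would be negative. For a root on the unit circle, the other
  one lies inside, so the two differ.
\<close>

lemma quadratic_root_condition:
  fixes t D \<mu> :: complex
  assumes D: "cmod D < 1"
    and t: "cmod (t - D * cnj t) \<le> 1 - (cmod D)\<^sup>2"
    and root: "poly [:D, - t, 1:] \<mu> = 0"
  shows "cmod \<mu> \<le> 1" and "cmod \<mu> = 1 \<Longrightarrow> order \<mu> [:D, - t, 1:] = 1"
proof -
  define \<nu> where "\<nu> = t - \<mu>"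
  have tD: "t = \<mu> + \<nu>" "D = \<mu> * \<nu>"
    using root by (auto simp: \<nu>_def algebra_simps add_eq_0_iff2)
  have fact: "[:D, - t, 1:] = [:- \<mu>, 1:] * [:- \<nu>, 1:]"
    by (simp add: tD)
  show "cmod \<mu> \<le> 1"
  proof (rule ccontr)
    assume "\<not> cmod \<mu> \<le> 1"
    then have \<mu>: "1 < cmod \<mu>" by simp
    have prod: "cmod \<mu> * cmod \<nu> < 1"
      using D by (simp add: tD norm_mult)
    have \<nu>: "cmod \<nu> < 1"
      using prod \<mu> mult_right_mono[of 1 "cmod \<mu>" "cmod \<nu>"] by simp
    have "\<mu> * cnj \<nu> \<noteq> 1"
      using prod by (metis complex_mod_cnj less_irrefl norm_mult norm_one)
    then have "0 < (cmod (1 - \<mu> * cnj \<nu>))\<^sup>2" by simp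
    moreover have "1 - (cmod \<mu>)\<^sup>2 < 0" "0 < 1 - (cmod \<nu>)\<^sup>2"
      using \<mu> \<nu> by (simp_all add: abs_square_less_1 power_less_one_iff)
    ultimately have "(1 - (cmod \<mu>)\<^sup>2) * (1 - (cmod \<nu>)\<^sup>2) * (cmod (1 - \<mu> * cnj \<nu>))\<^sup>2 < 0"
      by (simp add: mult_less_0_iff)
    moreover have "(cmod (t - D * cnj t))\<^sup>2 \<le> (1 - (cmod D)\<^sup>2)\<^sup>2"
      using t by (simp add: power_mono)
    ultimately show False
      using schur_cohn_identity[of \<mu> \<nu>] unfolding tD by linarith
  qed
  show "order \<mu> [:D, - t, 1:] = 1" if "cmod \<mu> = 1"
  proof -
    have "\<mu> \<noteq> \<nu>"
      using D that by (auto simp: tD norm_mult)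
    then have "order \<mu> [:- \<nu>, 1:] = 0"
      by (intro order_0I) auto
    then show ?thesis
      unfolding fact using order_power_n_n[of \<mu> 1] by (subst order_mult) auto
  qed
qed

definition amplification :: "complex \<Rightarrow> complex mat" where
  "amplification z =
    (let \<alpha> = (14/5 + 9/5 * z) / (1 - z); \<beta> = - (9/5 + 6/5 * z) / (1 - z)
     in mat_of_rows_list 2
       [[\<alpha>, \<beta>],
        [(14/5 + 9/5 * z - z / 12 * \<alpha>) / (1 - z), - (9/5 + 47/60 * z + z / 12 * \<beta>) / (1 - z)]])"

lemma implicit_scalar_iff:
  fixes z :: complex
  assumes "z \<noteq> 1"
  shows "x = c + z * x \<longleftrightarrow> x = c / (1 - z)"
  using assms by (auto simp: field_simps)

lemma vec_of_list_2_eq: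
  "vec_of_list [x, y] = mat_of_rows_list 2 [[a, b], [c, d]] *\<^sub>v vec_of_list [p, q]
   \<longleftrightarrow> x = a * p + b * q \<and> y = c * p + d * (q :: complex)"
  by (auto simp: vec_eq_iff mat_of_rows_list_def scalar_prod_def numeral_2_eq_2 less_Suc_eq)

lemma is_amplification_matrix: "is_amplification_matrix IE_EIS_3 amplification"
  unfolding is_amplification_matrix_def
proof (intro conjI allI impI)
  fix z :: complex
  show "amplification z \<in> carrier_mat 2 2"
    by (auto simp: amplification_def Let_def mat_of_rows_list_def)
next
  fix lam :: complex and h :: real and p q p' q' :: complex
  assume "h > 0" and re: "Re (lam * of_real h) \<le> 0"
  define z where "z = lam * of_real h"
  have z: "z \<noteq> 1" using re unfolding z_def[symmetric] by auto
  then have z': "1 - z \<noteq> 0" by simp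
  define \<alpha> where "\<alpha> = (14/5 + 9/5 * z) / (1 - z)"
  define \<beta> where "\<beta> = - (9/5 + 6/5 * z) / (1 - z)"
  have "IE_EIS_3 (\<lambda>x. lam * x) h (p, q) (p', q') \<longleftrightarrow>
      p' = ((14/5 + 9/5 * z) * p - (9/5 + 6/5 * z) * q) + z * p' \<and>
      q' = ((14/5 + 9/5 * z) * p - (9/5 + 47/60 * z) * q - z / 12 * p') + z * q'"
    unfolding IE_EIS_3_def z_def
    by (simp add: scaleR_conv_of_real algebra_simps)
  also have "\<dots> \<longleftrightarrow>
      p' = ((14/5 + 9/5 * z) * p - (9/5 + 6/5 * z) * q) / (1 - z) \<and>
      q' = ((14/5 + 9/5 * z) * p - (9/5 + 47/60 * z) * q - z / 12 * p') / (1 - z)"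
    by (simp only: implicit_scalar_iff[OF z])
  also have "\<dots> \<longleftrightarrow> p' = \<alpha> * p + \<beta> * q \<and>
      q' = ((14/5 + 9/5 * z) * p - (9/5 + 47/60 * z) * q - z / 12 * p') / (1 - z)"
  proof -
    have "(x * p - y * q) / w = x / w * p + - y / w * q" for x y w :: complex
      by (simp add: diff_divide_distrib)
    then show ?thesis unfolding \<alpha>_def \<beta>_def by (simp only:)
  qed
  also have "\<dots> \<longleftrightarrow> p' = \<alpha> * p + \<beta> * q \<and>
      q' = (14/5 + 9/5 * z - z / 12 * \<alpha>) / (1 - z) * p
         + - (9/5 + 47/60 * z + z / 12 * \<beta>) / (1 - z) * q"
  proof -
    have "((14/5 + 9/5 * z) * p - (9/5 + 47/60 * z) * q - z / 12 * (\<alpha> * p + \<beta> * q)) / (1 - z)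
        = (14/5 + 9/5 * z - z / 12 * \<alpha>) / (1 - z) * p
         + - (9/5 + 47/60 * z + z / 12 * \<beta>) / (1 - z) * q" for \<alpha> \<beta> :: complex
      using z' by (simp add: divide_simps) (simp add: algebra_simps)
    then show ?thesis by auto
  qed
  also have "\<dots> \<longleftrightarrow>
      vec_of_list [p', q'] = amplification z *\<^sub>v vec_of_list [p, q]"
    unfolding amplification_def Let_def vec_of_list_2_eq \<alpha>_def \<beta>_def ..
  finally show "IE_EIS_3 (\<lambda>x. lam * x) h (p, q) (p', q') \<longleftrightarrow>
      vec_of_list [p', q'] = amplification (lam * of_real h) *\<^sub>v vec_of_list [p, q]"
    unfolding z_def .
qed

lemma char_poly_amplification:
  assumes "z \<noteq> 1"
  shows "char_poly (amplification z) =
    [:(14 * z + 9 * z\<^sup>2) / (12 * (1 - z)\<^sup>2), - ((12 + 2 * z - 11 * z\<^sup>2) / (12 * (1 - z)\<^sup>2)), 1:]"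
proof -
  have "1 - z \<noteq> 0" using assms by simp
  then show ?thesis
    unfolding amplification_def Let_def char_poly_2x2
    by (simp add: divide_simps) (simp add: power2_eq_square algebra_simps)
qed

text \<open>
  In terms of \<open>A\<close>, \<open>B\<close>, \<open>C\<close>, the characteristic polynomial is \<open>\<mu>\<^sup>2 - B / A * \<mu> + C / A\<close>, and the two
  claims are the hypotheses of the root criterion with denominators cleared. With \<open>X = - Re z \<ge> 0\<close>
  and \<open>y = Im z\<close> both become inequalities between real polynomials. Direct expansion of the second
  has degree 8; writing it as \<open>V\<^sup>2 \<le> (W - U) * (W + U)\<close> and passing to \<open>X\<close> and \<open>r = X\<^sup>2 + y\<^sup>2\<close> reduces
  it to a polynomial in \<open>X\<close> and \<open>r\<close> with nonnegative coefficients. On the imaginary axis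
  \<open>W\<^sup>2 - U\<^sup>2 - V\<^sup>2\<close> vanishes to fourth order at \<open>z = 0\<close>, so crude bounds would fail there.
\<close>

lemma left_half_plane_inequalities:
  fixes z :: complex
  assumes "Re z \<le> 0"
  defines "A \<equiv> 12 * (1 - z)\<^sup>2" and "B \<equiv> 12 + 2 * z - 11 * z\<^sup>2" and "C \<equiv> 14 * z + 9 * z\<^sup>2"
  shows "cmod C < cmod A"
    and "cmod (cnj A * B - C * cnj B) \<le> (cmod A)\<^sup>2 - (cmod C)\<^sup>2"
proof -
  define X y where "X = - Re z" and "y = Im z"
  have X: "0 \<le> X" and z: "z = Complex (- X) y"
    using assms(1) by (simp_all add: X_def y_def)
  have A: "A = Complex (12 * ((1 + X)\<^sup>2 - y\<^sup>2)) (- 24 * (1 + X) * y)"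
    and B: "B = Complex (12 - 2 * X - 11 * (X\<^sup>2 - y\<^sup>2)) (2 * y + 22 * X * y)"
    and C: "C = Complex (9 * (X\<^sup>2 - y\<^sup>2) - 14 * X) (14 * y - 18 * X * y)"
    unfolding A_def B_def C_def z by (simp_all add: complex_eq_iff power2_eq_square algebra_simps)
  define W where "W = 144 + 92 * y^2 + 63 * y^4 + X * (576 + 828 * y^2) + X^2 * (668 + 126 * y^2)
    + 828 * X^3 + 63 * X^4"
  define U where "U = 144 + 20 * y^2 - 33 * y^4 + X * (432 - 424 * y^2) - X^2 * (172 + 66 * y^2)
    - 424 * X^3 - 33 * X^4"
  define V where "V = 144 * y + 68 * y^3 + 768 * X * y + 68 * X^2 * y"
  have W: "(cmod A)\<^sup>2 - (cmod C)\<^sup>2 = W"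
    unfolding A C cmod_power2 complex.sel W_def by (simp add: eval_nat_numeral algebra_simps)
  have UV: "cnj A * B - C * cnj B = Complex U V"
    unfolding A B C U_def V_def by (simp add: complex_eq_iff eval_nat_numeral algebra_simps)
  have "0 \<le> 92 * y^2 + 63 * y^4 + X * (576 + 828 * y^2) + X^2 * (668 + 126 * y^2) + 828 * X^3 + 63 * X^4"
    using X by (intro add_nonneg_nonneg mult_nonneg_nonneg) auto
  then have pos: "0 < W" unfolding W_def by linarith
  have "(cmod C)\<^sup>2 < (cmod A)\<^sup>2" using pos W by linarith
  then show "cmod C < cmod A"
    by (rule power2_less_imp_less) simp
  define r where "r = X^2 + y^2"
  define G where "G = 72 * r + 96 * r^2 + X * (144 + 1252 * r) + 768 * X^2"
  define H where "H = 288 + 112 * r + 30 * r^2 + X * (1008 + 404 * r) + 384 * X^2"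
  define Q where "Q = 144 + 768 * X + 68 * r"
  have r: "0 \<le> r" "y^2 \<le> r" by (simp_all add: r_def)
  have G: "W - U = G" and H: "W + U = H" and Q: "V = y * Q"
    unfolding W_def U_def V_def G_def H_def Q_def r_def
    by (simp_all add: eval_nat_numeral algebra_simps)
  \<comment> \<open>Replacing \<open>y\<^sup>2\<close> by the larger \<open>r\<close> only costs terms with a positive power of \<open>X\<close>.\<close>
  have "V\<^sup>2 \<le> r * Q\<^sup>2"
    using r by (simp add: Q power_mult_distrib mult_right_mono)
  moreover have "G * H - r * Q\<^sup>2 =
      16128 * r^2 + 8288 * r^3 + 2880 * r^4 + X * (41472 + 228096 * r + 165952 * r^2 + 76344 * r^3)
      + X^2 * (366336 + 844032 * r + 565712 * r^2) + X^3 * (829440 + 791040 * r) + 294912 * X^4"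
    unfolding G_def H_def Q_def by (simp add: eval_nat_numeral algebra_simps)
  moreover have "0 \<le> 16128 * r^2 + 8288 * r^3 + 2880 * r^4
      + X * (41472 + 228096 * r + 165952 * r^2 + 76344 * r^3)
      + X^2 * (366336 + 844032 * r + 565712 * r^2) + X^3 * (829440 + 791040 * r) + 294912 * X^4"
    using X r by (intro add_nonneg_nonneg mult_nonneg_nonneg) auto
  moreover have "W\<^sup>2 - U\<^sup>2 = G * H"
    unfolding G[symmetric] H[symmetric] by (simp add: power2_eq_square algebra_simps)
  ultimately have "U\<^sup>2 + V\<^sup>2 \<le> W\<^sup>2" by linarith
  then have "(cmod (Complex U V))\<^sup>2 \<le> W\<^sup>2"
    by (simp add: cmod_power2)
  then show "cmod (cnj A * B - C * cnj B) \<le> (cmod A)\<^sup>2 - (cmod C)\<^sup>2"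
    unfolding W UV by (rule power2_le_imp_le) (use pos in simp)
qed

lemma A_stable_IE_EIS_3: "A_stable IE_EIS_3"
  unfolding A_stable_def
proof (intro exI[of _ amplification] conjI is_amplification_matrix allI impI)
  fix z \<mu> :: complex
  assume z: "Re z \<le> 0" and ev: "eigenvalue (amplification z) \<mu>"
  define A B C where "A = 12 * (1 - z)\<^sup>2" and "B = 12 + 2 * z - 11 * z\<^sup>2" and "C = 14 * z + 9 * z\<^sup>2"
  note bounds = left_half_plane_inequalities[OF z, folded A_def B_def C_def]
  have A: "0 < cmod A"
    using bounds(1) norm_ge_zero[of C] by linarith
  have "z \<noteq> 1" using z by auto
  then have cp: "char_poly (amplification z) = [:C / A, - (B / A), 1:]"
    by (simp add: char_poly_amplification A_def B_def C_def)
  have "amplification z \<in> carrier_mat 2 2"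
    by (auto simp: amplification_def Let_def mat_of_rows_list_def)
  with ev have root: "poly [:C / A, - (B / A), 1:] \<mu> = 0"
    by (simp add: eigenvalue_root_char_poly cp)
  have 1: "cmod (C / A) < 1"
    using bounds(1) A by (simp add: norm_divide)
  have "B / A - C / A * cnj (B / A) = (cnj A * B - C * cnj B) / (A * cnj A)"
    using A by (auto simp: field_simps)
  then have "cmod (B / A - C / A * cnj (B / A)) = cmod (cnj A * B - C * cnj B) / (cmod A)\<^sup>2"
    by (simp add: norm_divide norm_mult power2_eq_square)
  also have "\<dots> \<le> ((cmod A)\<^sup>2 - (cmod C)\<^sup>2) / (cmod A)\<^sup>2"
    using bounds(2) by (simp add: divide_right_mono)
  also have "\<dots> = 1 - (cmod (C / A))\<^sup>2"
    using A by (simp add: norm_divide power_divide diff_divide_distrib)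
  finally have 2: "cmod (B / A - C / A * cnj (B / A)) \<le> 1 - (cmod (C / A))\<^sup>2" .
  show "cmod \<mu> \<le> 1"
    by (rule quadratic_root_condition(1)[OF 1 2 root])
  show "order \<mu> (char_poly (amplification z)) = 1" if "cmod \<mu> = 1"
    unfolding cp by (rule quadratic_root_condition(2)[OF 1 2 root that])
qed

theorem mainTheorem4:
  shows "third_order_accurate (IE_EIS_3 :: (real ^ 'm) pair_method) \<and>
         A_stable (IE_EIS_3 :: complex pair_method)"
  using third_order_accurate_IE_EIS_3 A_stable_IE_EIS_3 by blast

end
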